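(* Let $n\ge2$. The set of dominant, indivisible, $\mathfrak{p}^-$-admissible one-parameter subgroups of $T_{\mathbb{C}}$ associated to $G=SU(n,1)$ is $$\{\lambda_1,-\lambda_n\},\qquad\lambda_1=(n,-1,\dots,-1),\quad-\lambda_n=(1,\dots,1,-n).$$
   Context: For $G=SU(n,1)$ the maximal compact subgroup is $K\cong U(n)$, with complexification $GL_n(\mathbb{C})$; $T_{\mathbb{C}}$ is the torus of diagonal matrices of $GL_n(\mathbb{C})$. A one-parameter subgroup of $T_{\mathbb{C}}$ is $\lambda=(\lambda_1,\dots,\lambda_n)\in\mathbb{Z}^n$, i.e. $t\mapsto\mathrm{diag}(t^{\lambda_1},\dots,t^{\lambda_n})$. It is dominant if $\lambda_1\ge\dots\ge\lambda_n$, and indivisible if it is not $n'\lambda'$ with $n'>1$ an integer and $\lambda'\in\mathbb{Z}^n$. $\mathfrak{p}^-$ is the $n$-dimensional complex $K_{\mathbb{C}}$-module coming from the noncompact part of the Cartan decomposition of $\mathfrak{su}(n,1)$; the weights of $T_{\mathbb{C}}$ on it are $-\beta_1,\dots,-\beta_n$ (each of multiplicity one), with $\beta_k=e_k^*+\sum_{j=1}^ne_j^*$ ($e_j^*$ the $j$-th coordinate character). $\lambda$ is $\mathfrak{p}^-$-admissible if there is $v\in\mathfrak{p}^-$ such that $\lambda(\mathbb{C}^* )$ is the identity component of the stabilizer of $v$ in $T_{\mathbb{C}}$; equivalently, the line $\mathbb{C}\lambda\subset\mathfrak{t}_{\mathbb{C}}$ is the intersection of the kernels of a family of weights of $\mathfrak{p}^-$.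 *)

theory Defs
  imports "HOL-Analysis.Analysis"
begin

(* The coordinates of C^n are indexed by a finite linearly ordered type 'n (so n = CARD('n)) and
   those of C^(n+1) by 'n option, None being the last, negative, direction of the Hermitian form.
   A $ i $ j is the entry of A in row i and column j. *)

definition conj_transpose :: "complex^'m^'m \<Rightarrow> complex^'m^'m" where
  "conj_transpose A = (\<chi> i j. cnj (A $ j $ i))"

definition herm_form :: "complex^('n::finite option)^('n option)" where
  "herm_form = (\<chi> i j. if i \<noteq> j then 0 else if i = None then -1 else 1)"

definition su_n1 :: "(complex^('n::finite option)^('n option)) set" where
  "su_n1 = {X. conj_transpose X ** herm_form + herm_form ** X = 0 \<and> trace X = 0}"

definition cartan_involution ::
    "complex^('n::finite option)^('n option) \<Rightarrow> complex^('n option)^('n option)" where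
  "cartan_involution X = - conj_transpose X"

definition noncompact_part :: "(complex^('n::finite option)^('n option)) set" where
  "noncompact_part = {X \<in> su_n1. cartan_involution X = - X}"

(* The complexification of the noncompact part, realized inside sl_{n+1}(C). *)
definition p_complex :: "(complex^('n::finite option)^('n option)) set" where
  "p_complex = {\<chi> i j. A $ i $ j + \<i> * B $ i $ j | A B.
                  A \<in> noncompact_part \<and> B \<in> noncompact_part}"

(* p_complex splits under K_C into its upper right and lower left blocks; the lower left one is
   p^-, see the lemma Ad_weight below. *)
definition p_minus :: "(complex^('n::finite option)^('n option)) set" where
  "p_minus = {X \<in> p_complex. \<forall>i. X $ Some i $ None = 0}"

(* The isomorphism g |-> diag(g, 1 / det g) from GL_n(C) = K_C onto the complexification of
   K = S(U(n) x U(1)). *)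
definition embed_K :: "complex^'n^'n \<Rightarrow> complex^('n::finite option)^('n option)" where
  "embed_K g = (\<chi> i j. case (i, j) of
      (Some a, Some b) \<Rightarrow> g $ a $ b
    | (None, None) \<Rightarrow> inverse (det g)
    | _ \<Rightarrow> 0)"

definition Ad :: "complex^'n^'n \<Rightarrow> complex^('n::finite option)^('n option)
    \<Rightarrow> complex^('n option)^('n option)" where
  "Ad g X = embed_K g ** X ** matrix_inv (embed_K g)"

definition diag_mat :: "('n \<Rightarrow> complex) \<Rightarrow> complex^'n^'n" where
  "diag_mat d = (\<chi> i j. if i = j then d i else 0)"

definition torus :: "(complex^'n^'n) set" where
  "torus = {diag_mat d | d. \<forall>i. d i \<noteq> 0}"

definition torus_stabilizer ::
    "complex^('n::finite option)^('n option) \<Rightarrow> (complex^'n^'n) set" where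
  "torus_stabilizer v = {t \<in> torus. Ad t v = v}"

(* For a complex algebraic group such as a stabilizer, the identity components in the Euclidean
   and in the Zariski topology coincide; the Euclidean one is used here. *)
definition identity_component :: "(complex^'n^'n) set \<Rightarrow> (complex^'n^'n) set" where
  "identity_component H = connected_component_set H (mat 1)"

definition one_ps :: "int^'n \<Rightarrow> complex \<Rightarrow> complex^'n^'n" where
  "one_ps l z = diag_mat (\<lambda>i. z powi (l $ i))"

definition dominant :: "int^'n::{finite,linorder} \<Rightarrow> bool" where
  "dominant l \<longleftrightarrow> (\<forall>i j. i \<le> j \<longrightarrow> l $ j \<le> l $ i)"

definition indivisible :: "int^'n \<Rightarrow> bool" where
  "indivisible l \<longleftrightarrow> \<not> (\<exists>m l'. m > 1 \<and> l = m *s l')"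

definition p_minus_admissible :: "int^'n::finite \<Rightarrow> bool" where
  "p_minus_admissible l \<longleftrightarrow>
     (\<exists>v \<in> p_minus. one_ps l ` (- {0}) = identity_component (torus_stabilizer v))"

lemma diag_mat_mult: "(diag_mat a ** X) $ i $ j = a i * X $ i $ j"
proof -
  have "(diag_mat a ** X) $ i $ j = (\<Sum>k\<in>UNIV. if i = k then a i * X $ k $ j else 0)"
    unfolding matrix_matrix_mult_def diag_mat_def by (simp only: vec_lambda_beta) (rule sum.cong, auto)
  then show ?thesis
    by simp
qed

lemma mult_diag_mat: "(X ** diag_mat b) $ i $ j = X $ i $ j * b j"
proof -
  have "(X ** diag_mat b) $ i $ j = (\<Sum>k\<in>UNIV. if k = j then X $ i $ k * b j else 0)"
    unfolding matrix_matrix_mult_def diag_mat_def by (simp only: vec_lambda_beta) (rule sum.cong, auto)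
  then show ?thesis
    by simp
qed

lemma herm_form_diag: "herm_form = diag_mat (\<lambda>i. if i = None then -1 else 1)"
  by (simp add: herm_form_def diag_mat_def vec_eq_iff)

lemma noncompact_part_iff:
  "X \<in> noncompact_part \<longleftrightarrow> X $ None $ None = 0 \<and> (\<forall>a b. X $ Some a $ Some b = 0) \<and>
     (\<forall>a. X $ Some a $ None = cnj (X $ None $ Some a))"
  (is "?L \<longleftrightarrow> ?R")
proof -
  have J: "(conj_transpose X ** herm_form + herm_form ** X) $ i $ j =
      cnj (X $ j $ i) * herm_form $ j $ j + herm_form $ i $ i * X $ i $ j" for i j
    unfolding herm_form_diag vector_add_component mult_diag_mat diag_mat_mult
    by (simp add: conj_transpose_def diag_mat_def)
  have hd: "herm_form $ i $ i = (if i = None then -1 else 1)" for i :: "'a option"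
    by (simp add: herm_form_def)
  have th: "cartan_involution X = - X \<longleftrightarrow> (\<forall>i j. cnj (X $ j $ i) = X $ i $ j)"
    by (simp add: cartan_involution_def conj_transpose_def vec_eq_iff)
  have mem: "?L \<longleftrightarrow> (\<forall>i j. cnj (X $ j $ i) * herm_form $ j $ j + herm_form $ i $ i * X $ i $ j = 0)
      \<and> trace X = 0 \<and> (\<forall>i j. cnj (X $ j $ i) = X $ i $ j)"
    unfolding noncompact_part_def su_n1_def by (simp add: vec_eq_iff[of _ 0] J th
        del: vector_add_component)
  show ?thesis
  proof
    assume ?L
    then have H: "X $ i $ j * (herm_form $ j $ j + herm_form $ i $ i) = 0"
      and S: "cnj (X $ j $ i) = X $ i $ j" for i j
      by (auto simp: mem algebra_simps)
    show ?R
      using H[of None None] H[of "Some _" "Some _"] S by (auto simp: hd)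
  next
    assume R: ?R
    have S: "cnj (X $ j $ i) = X $ i $ j" for i j
      using R by (cases i; cases j) auto
    have "X $ i $ i = 0" for i
      using R by (cases i) auto
    then have "trace X = 0"
      by (simp add: trace_def)
    moreover have "cnj (X $ j $ i) * herm_form $ j $ j + herm_form $ i $ i * X $ i $ j = 0" for i j
      unfolding S using R by (cases i; cases j) (auto simp: hd)
    ultimately show ?L
      using S by (auto simp: mem)
  qed
qed

lemma p_minus_iff:
  "X \<in> p_minus \<longleftrightarrow> X $ None $ None = 0 \<and> (\<forall>a b. X $ Some a $ Some b = 0) \<and>
     (\<forall>a. X $ Some a $ None = 0)"
  (is "?L \<longleftrightarrow> ?R")
proof
  assume ?L
  then show ?R
    by (auto simp: p_minus_def p_complex_def noncompact_part_iff)
next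
  assume R: ?R
  define w where "w a = X $ None $ Some a" for a
  define A :: "complex^'a option^'a option" where "A = (\<chi> i j. case (i, j) of
      (None, Some a) \<Rightarrow> w a / 2 | (Some a, None) \<Rightarrow> cnj (w a) / 2 | _ \<Rightarrow> 0)"
  define B :: "complex^'a option^'a option" where "B = (\<chi> i j. case (i, j) of
      (None, Some a) \<Rightarrow> - \<i> * w a / 2 | (Some a, None) \<Rightarrow> \<i> * cnj (w a) / 2 | _ \<Rightarrow> 0)"
  have "A \<in> noncompact_part" "B \<in> noncompact_part"
    by (auto simp: noncompact_part_iff A_def B_def)
  moreover have "X = (\<chi> i j. A $ i $ j + \<i> * B $ i $ j)"
    using R by (auto simp: vec_eq_iff A_def B_def w_def split: option.splits)
  ultimately have "X \<in> p_complex"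
    unfolding p_complex_def by blast
  then show ?L
    using R by (simp add: p_minus_def)
qed

lemma det_diag_mat: "det (diag_mat d) = prod d UNIV"
  by (subst det_diagonal) (auto simp: diag_mat_def)

(* The torus acts on the entry at None, Some k by the character -beta_k. *)
lemma Ad_weight:
  assumes "\<forall>i. d i \<noteq> 0"
  shows "Ad (diag_mat d) X $ None $ Some k = inverse (d k * prod d UNIV) * X $ None $ Some k"
proof -
  define D where "D i = (case i of None \<Rightarrow> inverse (prod d UNIV) | Some a \<Rightarrow> d a)" for i
  have nz: "prod d UNIV \<noteq> 0"
    using assms by simp
  have Dnz: "D i \<noteq> 0" for i
    using assms nz by (auto simp: D_def split: option.splits)
  have emb: "embed_K (diag_mat d) = diag_mat D"
    unfolding embed_K_def det_diag_mat
    by (auto simp: vec_eq_iff D_def diag_mat_def split: option.splits)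
  have inv: "matrix_inv (diag_mat D) = diag_mat (\<lambda>i. inverse (D i))"
  proof -
    let ?E = "diag_mat (\<lambda>i. inverse (D i))"
    have r: "diag_mat D ** ?E = mat 1" and l: "?E ** diag_mat D = mat 1"
      by (simp_all add: vec_eq_iff diag_mat_mult) (simp_all add: diag_mat_def mat_def Dnz)
    then have "matrix_inv (diag_mat D) ** diag_mat D = mat 1"
      unfolding matrix_inv_def by (rule_tac someI2[of _ ?E]) auto
    then have "matrix_inv (diag_mat D) ** (diag_mat D ** ?E) = ?E"
      by (simp add: matrix_mul_assoc)
    then show ?thesis
      by (simp add: r)
  qed
  show ?thesis
    unfolding Ad_def emb inv mult_diag_mat diag_mat_mult by (simp add: D_def)
qed

end

(* If v has no zero coordinate then its stabilizer in T_C is finite, which only allows l = 0. If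
   v_m = 0, the stabilizer contains the connected group { diag(z, .., z^(-n), .., z) } with z^(-n)
   at position m, since all weights but -beta_m vanish on its generator; comparing moduli of the
   entries at z = 2 shows that an admissible l is an integer multiple of this generator, hence plus
   or minus it when indivisible. Dominance then forces m to be the last or the first index.
   Conversely, the vector vanishing exactly at m has precisely this group as its stabilizer. *)

theory Submission
  imports Defs
begin

section \<open>Torus stabilizers of vectors in \<open>p_minus\<close>\<close>

lemma diag_mat_eq_iff: "diag_mat a = diag_mat b \<longleftrightarrow> a = b"
proof
  assume "diag_mat a = diag_mat b"
  then have "diag_mat a $ i $ i = diag_mat b $ i $ i" for i
    by simp
  then show "a = b"
    by (simp add: diag_mat_def fun_eq_iff)
qed simp

lemma matrix_inv_unique:
  fixes A :: "'a::semiring_1^'n^'m"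
  assumes "A ** B = mat 1" "B ** A = mat 1"
  shows "matrix_inv A = B"
proof -
  have "matrix_inv A ** A = mat 1"
    unfolding matrix_inv_def by (rule someI2[of _ B]) (use assms in auto)
  then have "matrix_inv A ** (A ** B) = B"
    by (simp add: matrix_mul_assoc)
  then show ?thesis
    by (simp add: assms)
qed

lemma matrix_inv_diag_mat:
  assumes "\<forall>i. D i \<noteq> 0"
  shows "matrix_inv (diag_mat D) = diag_mat (\<lambda>i. inverse (D i))"
proof -
  let ?E = "diag_mat (\<lambda>i. inverse (D i))"
  have "diag_mat D ** ?E = mat 1" and "?E ** diag_mat D = mat 1"
    using assms
    by (simp_all add: vec_eq_iff diag_mat_mult) (simp_all add: diag_mat_def mat_def)
  then show ?thesis
    by (rule matrix_inv_unique)
qed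

text \<open>\<open>Ad_weight\<close> treats the bottom row only; fixing \<open>v\<close> is a
  condition on every entry.\<close>

lemma Ad_diag_mat:
  assumes "\<forall>i. d i \<noteq> 0"
  defines "D \<equiv> case_option (inverse (prod d UNIV)) d"
  shows "Ad (diag_mat d) X $ i $ j = D i * X $ i $ j * inverse (D j)"
proof -
  have "\<forall>i. D i \<noteq> 0"
    using assms by (auto simp: D_def split: option.splits)
  moreover have "embed_K (diag_mat d) = diag_mat D"
    unfolding embed_K_def det_diag_mat
    by (auto simp: vec_eq_iff D_def diag_mat_def split: option.splits)
  ultimately show ?thesis
    by (simp add: Ad_def matrix_inv_diag_mat diag_mat_mult mult_diag_mat)
qed

text \<open>A vector of \<open>p_minus\<close> lives in the entries at \<open>None\<close>,
  \<open>Some k\<close>, where the torus acts by \<open>-beta_k\<close>; each nonzero coordinate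
  therefore forces \<open>beta_k\<close> to be 1 on \<open>d\<close>.\<close>

lemma diag_mat_in_torus_stabilizer_iff:
  assumes d: "\<forall>i. d i \<noteq> 0" and v: "v \<in> p_minus"
  shows "diag_mat d \<in> torus_stabilizer v \<longleftrightarrow>
    (\<forall>k. v $ None $ Some k \<noteq> 0 \<longrightarrow> d k * prod d UNIV = 1)"
proof -
  have "diag_mat d \<in> torus"
    using d by (auto simp: torus_def)
  then have "diag_mat d \<in> torus_stabilizer v \<longleftrightarrow>
      (\<forall>i j. Ad (diag_mat d) v $ i $ j = v $ i $ j)"
    by (simp add: torus_stabilizer_def vec_eq_iff)
  also have "\<dots> \<longleftrightarrow> (\<forall>k. Ad (diag_mat d) v $ None $ Some k = v $ None $ Some k)"
  proof -
    have "Ad (diag_mat d) v $ i $ j = v $ i $ j"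
      if "\<forall>k. Ad (diag_mat d) v $ None $ Some k = v $ None $ Some k" for i j
      using that v d by (cases i; cases j) (auto simp: p_minus_iff Ad_diag_mat)
    then show ?thesis
      by blast
  qed
  also have "\<dots> \<longleftrightarrow> (\<forall>k. v $ None $ Some k \<noteq> 0 \<longrightarrow> d k * prod d UNIV = 1)"
    unfolding Ad_weight[OF d] by (auto simp: mult_cancel_right1 simp del: inverse_mult_distrib)
  finally show ?thesis .
qed

section \<open>One-parameter subgroups\<close>

lemma prod_power_int:
  fixes z :: "'a::field"
  assumes "z \<noteq> 0"
  shows "(\<Prod>i\<in>A. z powi f i) = z powi (\<Sum>i\<in>A. f i)"
  using assms by (induction A rule: infinite_finite_induct) (auto simp: power_int_add)

lemma ln_power_int:
  fixes x :: real
  assumes "x > 0"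
  shows "ln (x powi k) = of_int k * ln x"
  using assms by (simp add: powr_real_of_int' ln_powr flip: powr_real_of_int')

text \<open>On \<open>one_ps l z\<close> the character \<open>beta_k\<close> is a power of
  \<open>z\<close> whose exponent is the pairing of \<open>beta_k\<close> with
  \<open>l\<close>.\<close>

lemma one_ps_in_torus_stabilizer_iff:
  assumes "z \<noteq> 0" "v \<in> p_minus"
  shows "one_ps l z \<in> torus_stabilizer v \<longleftrightarrow>
    (\<forall>k. v $ None $ Some k \<noteq> 0 \<longrightarrow> z powi (l $ k + (\<Sum>i\<in>UNIV. l $ i)) = 1)"
  using assms
  by (simp add: one_ps_def diag_mat_in_torus_stabilizer_iff prod_power_int power_int_add)

text \<open>The punctured complex plane is connected, its real dimension being 2, and integer powers
  are continuous away from 0.\<close>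

lemma connected_one_ps: "connected (one_ps l ` (- {0}))"
proof (rule connected_continuous_image)
  show "connected (- {0 :: complex})"
    by (rule connected_punctured_universe) simp
  have "continuous_on (- {0}) (\<lambda>z. if i = j then z powi (l $ i) else 0 :: complex)" for i j
    by (cases "i = j") (auto intro!: continuous_intros)
  then show "continuous_on (- {0}) (one_ps l)"
    unfolding one_ps_def diag_mat_def by (intro continuous_on_vec_lambda)
qed

lemma one_ps_1: "one_ps l 1 = mat 1"
  by (simp add: one_ps_def diag_mat_def mat_def)

text \<open>The image is connected and passes through \<open>mat 1\<close> at
  \<open>z = 1\<close>.\<close>

lemma one_ps_subset_identity_component:
  assumes "one_ps l ` (- {0}) \<subseteq> H"
  shows "one_ps l ` (- {0}) \<subseteq> identity_component H"
  unfolding identity_component_def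
proof (rule connected_component_maximal)
  show "mat 1 \<in> one_ps l ` (- {0})"
    by (rule image_eqI[of _ _ 1]) (simp_all add: one_ps_1)
qed (use assms connected_one_ps in auto)

text \<open>Comparing moduli turns an equality of torus elements into proportionality of exponents.\<close>
lemma one_ps_eq_imp_proportional:
  assumes eq: "one_ps k 2 = one_ps l w" and "w \<noteq> 0" and j: "k $ j = 1"
  shows "l = l $ j *s k"
proof -
  have "(2::complex) powi (k $ i) = w powi (l $ i)" for i
    using eq by (simp add: one_ps_def diag_mat_eq_iff fun_eq_iff)
  then have "norm ((2::complex) powi (k $ i)) = norm (w powi (l $ i))" for i
    by simp
  then have "ln ((2::real) powi (k $ i)) = ln (norm w powi (l $ i))" for i
    by (simp add: norm_power_int)
  then have L: "of_int (k $ i) * ln 2 = of_int (l $ i) * ln (norm w)" for i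
    using \<open>w \<noteq> 0\<close> by (simp add: ln_power_int)
  \<comment> \<open>The unit coordinate of \<open>k\<close> expresses \<open>ln 2\<close> through
    \<open>ln (norm w)\<close>, which is therefore nonzero and can be cancelled below.\<close>
  have l2: "ln 2 = of_int (l $ j) * ln (norm w)"
    using L[of j] j by simp
  then have ln_w: "ln (norm w) \<noteq> 0"
    by fastforce
  have "l $ i = l $ j * k $ i" for i
  proof -
    have "of_int (l $ i) * ln (norm w) = of_int (k $ i) * (of_int (l $ j) * ln (norm w))"
      using L[of i] unfolding l2 by (rule sym)
    then have "ln (norm w) * of_int (l $ i) = ln (norm w) * of_int (l $ j * k $ i)"
      unfolding of_int_mult by (simp only: mult_ac)
    then have "real_of_int (l $ i) = of_int (l $ j * k $ i)"
      by (rule mult_left_cancel[OF ln_w, THEN iffD1])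
    then show ?thesis
      by (simp only: of_int_eq_iff)
  qed
  then show ?thesis
    unfolding vec_eq_iff vector_smult_component by blast
qed

section \<open>Indivisible vectors and the lines cut out by weights\<close>

lemma indivisible_nonzero: "indivisible l \<Longrightarrow> l \<noteq> 0"
  unfolding indivisible_def by (metis one_less_numeral_iff semiring_norm(76) vector_smult_rzero)

lemma indivisible_smult:
  assumes "indivisible (r *s k)"
  shows "r *s k = k \<or> r *s k = - k"
proof -
  have "\<not> r > 1"
    using assms by (auto simp: indivisible_def)
  moreover have "\<not> r < -1"
  proof
    assume "r < -1"
    \<comment> \<open>Divisibility asks for a positive factor, so the sign moves into the
      vector.\<close>
    moreover have "r *s k = (- r) *s (- k)"
      by (simp add: vec_eq_iff)
    ultimately show False
      using assms unfolding indivisible_def by (metis less_minus_iff minus_minus neg_less_iff_less)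
  qed
  moreover have "r \<noteq> 0"
    using indivisible_nonzero[OF assms] by auto
  ultimately have "r = 1 \<or> r = -1"
    by linarith
  then show ?thesis
    by (auto simp: vec_eq_iff)
qed

text \<open>A factor \<open>m > 1\<close> of \<open>l\<close> would divide the unit
  \<open>l $ j\<close>.\<close>

lemma indivisible_of_unit_coord:
  assumes "\<bar>l $ j\<bar> = 1"
  shows "indivisible l"
  unfolding indivisible_def
proof
  assume "\<exists>m l'. m > 1 \<and> l = m *s l'"
  then obtain m l' where "m > 1" "l $ j = m * l' $ j"
    by auto
  then have "m dvd l $ j" "\<not> is_unit m"
    by auto
  then show False
    using assms by (metis dvd_abs_iff)
qed

text \<open>The generator of the line cut out by all the weights of \<open>p_minus\<close> except the one at \<open>m\<close>.\<close>
definition weight_line :: "'n::finite \<Rightarrow> int^'n" where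
  "weight_line m = (\<chi> i. if i = m then - int CARD('n) else 1)"

text \<open>The entry \<open>-n\<close> is added to \<open>n - 1\<close> ones. Hence
  \<open>beta_k\<close> pairs with \<open>weight_line m\<close> to \<open>1 + (-1) = 0\<close> for
  every \<open>k\<close> other than \<open>m\<close>.\<close>

lemma sum_weight_line: "(\<Sum>i\<in>UNIV. weight_line m $ i) = -1"
proof -
  have "(\<Sum>i\<in>UNIV. weight_line m $ i) = weight_line m $ m + (\<Sum>i\<in>UNIV - {m}. weight_line m $ i)"
    by (rule sum.remove) auto
  also have "(\<Sum>i\<in>UNIV - {m}. weight_line m $ i) = (\<Sum>i\<in>UNIV - {m}. 1)"
    by (rule sum.cong) (auto simp: weight_line_def)
  also have "\<dots> = int CARD('a) - 1"
    by (simp add: of_nat_diff Suc_le_eq)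
  finally show ?thesis
    by (simp add: weight_line_def)
qed

lemma one_ps_weight_line_stabilizes:
  assumes "v \<in> p_minus" "v $ None $ Some m = 0"
  shows "one_ps (weight_line m) ` (- {0}) \<subseteq> torus_stabilizer v"
proof (intro image_subsetI)
  fix z :: complex
  assume "z \<in> - {0}"
  moreover have "weight_line m $ k = 1" if "v $ None $ Some k \<noteq> 0" for k
    using assms that by (auto simp: weight_line_def)
  ultimately show "one_ps (weight_line m) z \<in> torus_stabilizer v"
    using assms by (auto simp: one_ps_in_torus_stabilizer_iff sum_weight_line)
qed

section \<open>Necessity: indivisible admissible subgroups generate weight lines\<close>

lemma exists_other_index:
  fixes m :: "'n::finite"
  assumes "CARD('n) \<ge> 2"
  obtains j where "j \<noteq> m"
proof -
  have "UNIV \<noteq> {m}"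
    using assms by (metis card.empty card.insert empty_iff finite.emptyI not_less_eq_eq
        numeral_2_eq_2 order_refl)
  then show ?thesis
    using that by blast
qed

lemma admissible_imp_weight_line:
  fixes l :: "int^'n::finite"
  assumes n: "CARD('n) \<ge> 2" and l: "indivisible l" "p_minus_admissible l"
  shows "\<exists>m. l = weight_line m \<or> l = - weight_line m"
proof -
  obtain v where v: "v \<in> p_minus"
    and comp: "one_ps l ` (- {0}) = identity_component (torus_stabilizer v)"
    using l(2) by (auto simp: p_minus_admissible_def)
  have "\<exists>m. v $ None $ Some m = 0"
  proof (rule ccontr)
    assume full: "\<nexists>m. v $ None $ Some m = 0"
    let ?s = "\<Sum>i\<in>UNIV. l $ i"
    \<comment> \<open>The modulus of 2 is not 1, so a power of 2 equal to 1 has exponent 0;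
      logarithms of moduli extract this.\<close>
    have "one_ps l 2 \<in> torus_stabilizer v"
      using comp connected_component_subset unfolding identity_component_def by fastforce
    then have "(2::complex) powi (l $ k + ?s) = 1" for k
      using v full by (simp add: one_ps_in_torus_stabilizer_iff)
    then have "norm ((2::complex) powi (l $ k + ?s)) = 1" for k
      by simp
    then have "ln ((2::real) powi (l $ k + ?s)) = 0" for k
      by (simp add: norm_power_int)
    then have "l $ k + ?s = 0" for k
      by (simp add: ln_power_int flip: of_int_add of_int_sum)
    then have lk: "l $ k = - ?s" for k
      by (simp only: eq_neg_iff_add_eq_0)
    \<comment> \<open>Summing \<open>l $ k = - ?s\<close> over all \<open>n\<close> indices gives
      \<open>?s = - n * ?s\<close>, which forces \<open>?s = 0\<close>.\<close>
    have "?s = (\<Sum>i\<in>(UNIV :: 'n set). - ?s)"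
      by (rule sum.cong[OF refl lk])
    also have "\<dots> = - int CARD('n) * ?s"
      by simp
    finally have "(1 + int CARD('n)) * ?s = 0"
      by (metis eq_neg_iff_add_eq_0 mult.commute mult_minus_left
          mult_1 distrib_right)
    then have "?s = 0"
      by (simp add: mult_eq_0_iff)
    then have "l = 0"
      using lk unfolding vec_eq_iff by (metis neg_0_equal_iff_equal zero_index)
    then show False
      using indivisible_nonzero l(1) by blast
  qed
  then obtain m where m: "v $ None $ Some m = 0"
    by blast
  obtain j where j: "j \<noteq> m"
    using exists_other_index[OF n] .
  have "one_ps (weight_line m) 2 \<in> one_ps l ` (- {0})"
    using one_ps_subset_identity_component[OF one_ps_weight_line_stabilizes[OF v m]] comp by auto
  then obtain w where "w \<noteq> 0" "one_ps (weight_line m) 2 = one_ps l w"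
    by auto
  \<comment> \<open>\<open>weight_line m\<close> is 1 at \<open>j\<close>, the unit coordinate that
    the comparison of moduli requires.\<close>
  then have "l = l $ j *s weight_line m"
    using j by (intro one_ps_eq_imp_proportional) (auto simp: weight_line_def)
  then obtain r where "l = r *s weight_line m"
    by blast
  then show ?thesis
    using indivisible_smult l(1) by blast
qed

section \<open>Sufficiency: weight lines are admissible\<close>

text \<open>Inversion permutes the punctured plane and negates exponents. Admissibility depends only
  on this image, so it passes from \<open>l\<close> to \<open>- l\<close>.\<close>

lemma one_ps_uminus_image: "one_ps (- l) ` (- {0}) = one_ps l ` (- {0})"
proof -
  have "one_ps (- l) z = one_ps l (inverse z)" for z
    by (simp add: one_ps_def power_int_minus power_int_inverse)
  moreover have "inverse ` (- {0 :: complex}) = - {0}"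
    by (force intro: image_eqI[of _ _ "inverse _"])
  ultimately show ?thesis
    by (metis (no_types, lifting) image_cong image_image)
qed

text \<open>For \<open>v\<close> vanishing only at \<open>m\<close> the stabilizer is already
  connected, so passing to its identity component changes nothing.\<close>

lemma weight_line_admissible:
  fixes m :: "'n::finite"
  assumes n: "CARD('n) \<ge> 2"
  shows "p_minus_admissible (weight_line m)"
proof -
  define v :: "complex^'n option^'n option" where "v = (\<chi> i j. case (i, j) of
      (None, Some k) \<Rightarrow> if k = m then 0 else 1 | _ \<Rightarrow> 0)"
  have v: "v \<in> p_minus" "v $ None $ Some k = 0 \<longleftrightarrow> k = m" for k
    by (auto simp: p_minus_iff v_def)
  obtain j where j: "j \<noteq> m"
    using exists_other_index[OF n] .
  have "torus_stabilizer v \<subseteq> one_ps (weight_line m) ` (- {0})"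
  proof
    fix t
    assume t: "t \<in> torus_stabilizer v"
    then obtain d where d: "t = diag_mat d" "\<forall>i. d i \<noteq> 0"
      by (auto simp: torus_stabilizer_def torus_def)
    let ?P = "prod d UNIV"
    have "d k * ?P = 1" if "k \<noteq> m" for k
      using t d v that by (simp add: diag_mat_in_torus_stabilizer_iff)
    then have dk: "d k = inverse ?P" if "k \<noteq> m" for k
      using that by (metis inverse_unique mult.commute)
    \<comment> \<open>All entries off \<open>m\<close> equal \<open>inverse ?P\<close>; isolating
      the factor \<open>d m\<close> gives \<open>d m * inverse ?P ^ n = 1\<close>, so
      \<open>t\<close> is the value at the parameter \<open>inverse ?P\<close>.\<close>
    have "?P = d m * (\<Prod>k\<in>UNIV - {m}. d k)"
      by (rule prod.remove) auto
    also have "(\<Prod>k\<in>UNIV - {m}. d k) = (\<Prod>k\<in>UNIV - {m}. inverse ?P)"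
      by (rule prod.cong) (auto simp: dk)
    also have "\<dots> = inverse ?P ^ (CARD('n) - 1)"
      by simp
    finally have "d m * inverse ?P ^ (CARD('n) - 1) * inverse ?P = 1"
      using d(2) by (simp add: field_simps)
    then have "d m * inverse ?P ^ CARD('n) = 1"
      by (simp add: power_eq_if mult_ac)
    then have "d m = inverse ?P powi (- int CARD('n))"
      using d(2) by (simp add: power_int_minus field_simps)
    then have "t = one_ps (weight_line m) (inverse ?P)"
      using dk d(1) by (auto simp: one_ps_def weight_line_def diag_mat_eq_iff fun_eq_iff)
    then show "t \<in> one_ps (weight_line m) ` (- {0})"
      using d(2) by auto
  qed
  then have "torus_stabilizer v = one_ps (weight_line m) ` (- {0})"
    using one_ps_weight_line_stabilizes v by blast
  moreover have "identity_component (torus_stabilizer v) \<subseteq> torus_stabilizer v"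
    unfolding identity_component_def by (rule connected_component_subset)
  ultimately have "one_ps (weight_line m) ` (- {0}) = identity_component (torus_stabilizer v)"
    using one_ps_subset_identity_component[of "weight_line m" "torus_stabilizer v"] by blast
  then show ?thesis
    using v(1) by (auto simp: p_minus_admissible_def)
qed

section \<open>Dominance and the classification\<close>

text \<open>The entry \<open>-n\<close> at \<open>m\<close> is strictly the smallest, so it must
  come last.\<close>

lemma dominant_weight_line_iff:
  "dominant (weight_line (m :: 'n::{finite,linorder})) \<longleftrightarrow> m = Max UNIV"
proof
  assume "dominant (weight_line m)"
  then have "weight_line m $ Max UNIV \<le> weight_line m $ m"
    by (simp add: dominant_def)
  then show "m = Max UNIV"
    by (auto simp: weight_line_def split: if_splits)
next
  assume m: "m = Max UNIV"
  have "j = m" if "m \<le> j" for j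
    using that m by (simp add: order_antisym)
  then show "dominant (weight_line m)"
    by (auto simp: dominant_def weight_line_def)
qed

text \<open>Negation makes the entry at \<open>m\<close> strictly the largest, so it must come
  first.\<close>

lemma dominant_uminus_weight_line_iff:
  "dominant (- weight_line (m :: 'n::{finite,linorder})) \<longleftrightarrow> m = Min UNIV"
proof
  assume "dominant (- weight_line m)"
  then have "(- weight_line m) $ m \<le> (- weight_line m) $ Min UNIV"
    by (simp add: dominant_def del: uminus_vec_def)
  then show "m = Min UNIV"
    by (auto simp: weight_line_def split: if_splits)
next
  assume m: "m = Min UNIV"
  have "j = m" if "j \<le> m" for j
    using that m by (simp add: order_antisym)
  then show "dominant (- weight_line m)"
    by (auto simp: dominant_def weight_line_def)
qed

theorem mainTheorem13:
  assumes "CARD('n::{finite,linorder}) \<ge> 2"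
  shows "{l :: int^'n::{finite,linorder}. dominant l \<and> indivisible l \<and> p_minus_admissible l} =
    {\<chi> i. if i = Min UNIV then int CARD('n::{finite,linorder}) else -1,
     \<chi> i. if i = Max UNIV then - int CARD('n::{finite,linorder}) else 1}"
proof -
  have admissible: "p_minus_admissible (weight_line m)" "p_minus_admissible (- weight_line m)"
    for m :: 'n
    using weight_line_admissible[OF assms] by (auto simp: p_minus_admissible_def one_ps_uminus_image)
  have "indivisible (weight_line m)" "indivisible (- weight_line m)" for m :: 'n
  proof -
    obtain j where "j \<noteq> m"
      using exists_other_index[OF assms] .
    then show "indivisible (weight_line m)" "indivisible (- weight_line m)"
      by (auto intro!: indivisible_of_unit_coord[of _ j] simp: weight_line_def)
  qed
  \<comment> \<open>Dominance fixes \<open>m\<close> in each of the two signed families, leaving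
    \<open>(n, -1, ..., -1)\<close> and \<open>(1, ..., 1, -n)\<close>.\<close>
  then have "dominant l \<and> indivisible l \<and> p_minus_admissible l \<longleftrightarrow>
      l = - weight_line (Min UNIV) \<or> l = weight_line (Max UNIV)" for l :: "int^'n::{finite,linorder}"
    using admissible admissible_imp_weight_line[OF assms, of l]
      dominant_weight_line_iff dominant_uminus_weight_line_iff by metis
  then have "{l :: int^'n::{finite,linorder}. dominant l \<and> indivisible l \<and> p_minus_admissible l} =
      {- weight_line (Min UNIV), weight_line (Max UNIV)}"
    by auto
  moreover have "- weight_line (Min UNIV) =
      (\<chi> i :: 'n. if i = Min UNIV then int CARD('n) else -1)"
    by (simp add: weight_line_def vec_eq_iff)
  ultimately show ?thesis
    by (simp add: weight_line_def)
qed

end
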